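(* Let $\mathcal{F} \subseteq {}^{\omega}\omega$ be a maximal eventually different family such that $\mathcal{F} \times \mathcal{G}$ is maximal eventually different for any other maximal eventually different family $\mathcal{G} \subseteq {}^{\omega}\omega$ (i.e. for every maximal eventually different family $\mathcal{G} \subseteq {}^{\omega}\omega$). Then $\mathcal{F}$ is Van Douwen.
   Context: For countable sets $A,B$ and $f,g \in {}^{A}B$ (functions from $A$ to $B$) let $E(f,g) := \{a \in A \mid f(a) = g(a)\}$; $f$ and $g$ are eventually different if $E(f,g)$ is finite. A family $\mathcal{F} \subseteq {}^{A}B$ is eventually different (ed) if its members are pairwise eventually different, and it is maximal eventually different (med) if it is maximal with respect to inclusion among ed families contained in ${}^{A}B$. For functions $f,g$ with the same domain, $(f\times g)(a) := (f(a),g(a))$, and for families $\mathcal{F},\mathcal{G} \subseteq {}^{\omega}\omega$, $\mathcal{F}\times\mathcal{G} := \{f \times g \mid f \in \mathcal{F}, g \in \mathcal{G}\} \subseteq {}^{\omega}(\omega\times\omega)$; maximality of $\mathcal{F}\times\mathcal{G}$ is meant among ed families in ${}^{\omega}(\omega\times\omega)$. A med family $\mathcal{F} \subseteq {}^\omega\omega$ is Van Douwen if for every infinite $A \subseteq \omega$ the family $\mathcal{F}\restriction A := \{f \restriction A \mid f \in \mathcal{F}\}$ is a med family in ${}^{A}\omega$. *)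

theory Defs
  imports Main "HOL-Library.FuncSet"
begin

text \<open>
  The set of functions from \<open>A\<close> to \<open>B\<close> is rendered as the extensional function space
  \<open>A \<rightarrow>\<^sub>E B\<close>, so that functions on a proper subset \<open>A\<close> of \<open>\<omega>\<close> are equal iff they agree on \<open>A\<close>.
  For \<open>A = UNIV\<close> and \<open>B = UNIV\<close> it is the full function type; \<open>\<omega>\<close> is \<open>UNIV :: nat set\<close>.
\<close>

definition agreement_set :: "'a set \<Rightarrow> ('a \<Rightarrow> 'b) \<Rightarrow> ('a \<Rightarrow> 'b) \<Rightarrow> 'a set" where
  "agreement_set A f g = {a \<in> A. f a = g a}"

definition eventually_different :: "'a set \<Rightarrow> ('a \<Rightarrow> 'b) \<Rightarrow> ('a \<Rightarrow> 'b) \<Rightarrow> bool" where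
  "eventually_different A f g \<longleftrightarrow> finite (agreement_set A f g)"

definition ed_family :: "'a set \<Rightarrow> 'b set \<Rightarrow> ('a \<Rightarrow> 'b) set \<Rightarrow> bool" where
  "ed_family A B \<F> \<longleftrightarrow> \<F> \<subseteq> (A \<rightarrow>\<^sub>E B) \<and> pairwise (eventually_different A) \<F>"

definition med_family :: "'a set \<Rightarrow> 'b set \<Rightarrow> ('a \<Rightarrow> 'b) set \<Rightarrow> bool" where
  "med_family A B \<F> \<longleftrightarrow>
     ed_family A B \<F> \<and> (\<forall>\<G>. ed_family A B \<G> \<and> \<F> \<subseteq> \<G> \<longrightarrow> \<G> = \<F>)"

definition fun_prod :: "('a \<Rightarrow> 'b) \<Rightarrow> ('a \<Rightarrow> 'c) \<Rightarrow> 'a \<Rightarrow> 'b \<times> 'c" where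
  "fun_prod f g = (\<lambda>a. (f a, g a))"

definition family_prod :: "(nat \<Rightarrow> nat) set \<Rightarrow> (nat \<Rightarrow> nat) set \<Rightarrow> (nat \<Rightarrow> nat \<times> nat) set" where
  "family_prod \<F> \<G> = {fun_prod f g | f g. f \<in> \<F> \<and> g \<in> \<G>}"

definition restrict_family :: "('a \<Rightarrow> 'b) set \<Rightarrow> 'a set \<Rightarrow> ('a \<Rightarrow> 'b) set" where
  "restrict_family \<F> A = (\<lambda>f. restrict f A) ` \<F>"

definition van_Douwen :: "(nat \<Rightarrow> nat) set \<Rightarrow> bool" where
  "van_Douwen \<F> \<longleftrightarrow>
     med_family UNIV UNIV \<F> \<and>
     (\<forall>A. infinite A \<longrightarrow> med_family A UNIV (restrict_family \<F> A))"

end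

theory Submission
  imports Defs "HOL-Library.Countable_Set"
begin

text \<open>
  Suppose \<open>\<F>\<close> is not Van Douwen. Then on some infinite \<open>A\<close> there is a function \<open>h\<close> eventually
  different from every \<open>f \<in> \<F>\<close>. It suffices to find a maximal eventually different family \<open>\<G>\<close>
  all of whose members avoid the value \<open>0\<close> outside \<open>A\<close>: the function that is \<open>(h n, 0)\<close> for
  \<open>n \<in> A\<close> and \<open>(0, 0)\<close> elsewhere is then eventually different from each \<open>f \<times> g\<close>, because on \<open>A\<close>
  the first coordinates differ almost everywhere and off \<open>A\<close> the second coordinates always differ.
  This contradicts the maximality of \<open>\<F> \<times> \<G>\<close>.

  The family \<open>\<G>\<close> comes from a copy of \<open>\<F>\<close> on \<open>A\<close>, transported along a bijection between \<open>A\<close> and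
  \<open>\<omega>\<close>. This copy already meets every function infinitely often inside \<open>A\<close>, so maximality is
  secured whatever the values off \<open>A\<close> are. There, each copied function follows the branch of the
  tree of finite sequences determined by the original one; distinct branches share only finitely
  many nodes, so eventual difference is preserved, and coding the nodes by positive numbers
  avoids \<open>0\<close>.
\<close>

text \<open>
  On an infinite domain a function is not eventually different from itself, so a function
  eventually different from the whole family would be a genuinely new member.
\<close>

lemma med_family_iff_meets_infinitely_often:
  assumes "infinite A"
  shows "med_family A B \<F> \<longleftrightarrow>
    ed_family A B \<F> \<and> (\<forall>h \<in> A \<rightarrow>\<^sub>E B. \<exists>f\<in>\<F>. infinite (agreement_set A f h))"
    (is "?L \<longleftrightarrow> ?R")
proof
  assume L: ?L
  then have ed: "ed_family A B \<F>"
    by (simp add: med_family_def)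
  have "\<exists>f\<in>\<F>. infinite (agreement_set A f h)" if h: "h \<in> A \<rightarrow>\<^sub>E B" for h
  proof (rule ccontr)
    assume "\<not> ?thesis"
    then have fin: "finite (agreement_set A f h)" if "f \<in> \<F>" for f
      using that by blast
    have sym: "agreement_set A h f = agreement_set A f h" for f
      by (auto simp: agreement_set_def)
    have "ed_family A B (insert h \<F>)"
      using ed h fin by (auto simp: ed_family_def pairwise_insert eventually_different_def sym)
    then have "h \<in> \<F>"
      using L unfolding med_family_def by blast
    then have "finite (agreement_set A h h)"
      by (rule fin)
    then show False
      using assms by (simp add: agreement_set_def)
  qed
  with ed show ?R by blast
next
  assume R: ?R
  have "\<G> \<subseteq> \<F>" if \<G>: "ed_family A B \<G>" "\<F> \<subseteq> \<G>" for \<G>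
  proof
    fix h assume h: "h \<in> \<G>"
    then have "h \<in> A \<rightarrow>\<^sub>E B"
      using \<G>(1) by (auto simp: ed_family_def)
    then obtain f where f: "f \<in> \<F>" "infinite (agreement_set A f h)"
      using R by blast
    have "f = h"
    proof (rule ccontr)
      assume "f \<noteq> h"
      then have "eventually_different A f h"
        using \<G> f(1) h by (auto simp: ed_family_def pairwise_def)
      then show False
        using f(2) by (simp add: eventually_different_def)
    qed
    with f(1) show "h \<in> \<F>" by simp
  qed
  with R show ?L
    by (auto simp: med_family_def)
qed

lemma ed_family_restrict:
  assumes "ed_family UNIV UNIV \<F>"
  shows "ed_family A UNIV (restrict_family \<F> A)"
proof -
  have "eventually_different A (restrict f A) (restrict g A)"
    if "f \<in> \<F>" "g \<in> \<F>" "restrict f A \<noteq> restrict g A" for f g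
  proof -
    have "f \<noteq> g" using that(3) by auto
    then have "finite (agreement_set UNIV f g)"
      using assms that(1,2)
      by (auto simp: ed_family_def eventually_different_def dest: pairwiseD)
    moreover have "agreement_set A (restrict f A) (restrict g A) \<subseteq> agreement_set UNIV f g"
      by (auto simp: agreement_set_def)
    ultimately show ?thesis
      unfolding eventually_different_def by (rule rev_finite_subset)
  qed
  then show ?thesis
    unfolding ed_family_def restrict_family_def pairwise_def by fastforce
qed

text \<open>
  The node at height \<open>n\<close> of the branch of \<open>f\<close> through the tree of finite sequences, coded by a
  positive number so that \<open>0\<close> is never taken.
\<close>

definition branch_code :: "(nat \<Rightarrow> nat) \<Rightarrow> nat \<Rightarrow> nat" where
  "branch_code f n = Suc (to_nat (map f [0..<n]))"

lemma finite_branch_code_agreement: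
  assumes "f \<noteq> g"
  shows "finite {n. branch_code f n = branch_code g n}"
proof -
  obtain m where m: "f m \<noteq> g m" using assms by blast
  have "n \<le> m" if "branch_code f n = branch_code g n" for n
    using that m unfolding branch_code_def by (auto simp: not_less[symmetric])
  then have "{n. branch_code f n = branch_code g n} \<subseteq> {..m}" by auto
  then show ?thesis by (rule finite_subset) simp
qed

text \<open>
  Here \<open>to_nat_on A\<close> is the bijection from \<open>A\<close> onto \<open>\<omega>\<close> that carries \<open>f\<close> to its copy on \<open>A\<close>.
\<close>

definition copy_on :: "nat set \<Rightarrow> (nat \<Rightarrow> nat) \<Rightarrow> nat \<Rightarrow> nat" where
  "copy_on A f n = (if n \<in> A then f (to_nat_on A n) else branch_code f n)"

text \<open>
  Maximality is decided inside \<open>A\<close> alone: pulling \<open>h\<close> back to \<open>\<omega>\<close> along the bijection gives a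
  function that some \<open>f \<in> \<F>\<close> meets infinitely often, and the copy of \<open>f\<close> meets \<open>h\<close> at the
  corresponding points of \<open>A\<close>.
\<close>

lemma med_family_copy_on:
  assumes "infinite A" and med: "med_family UNIV UNIV \<F>"
  shows "med_family UNIV UNIV (copy_on A ` \<F>)"
proof -
  define \<phi> where "\<phi> = to_nat_on A"
  have \<phi>: "bij_betw \<phi> A UNIV"
    unfolding \<phi>_def using assms(1) by (intro to_nat_on_infinite) auto
  have "eventually_different UNIV (copy_on A f) (copy_on A g)"
    if "f \<in> \<F>" "g \<in> \<F>" "copy_on A f \<noteq> copy_on A g" for f g
  proof -
    have ne: "f \<noteq> g" using that(3) by auto
    have "finite (agreement_set UNIV f g)"
      using med that(1,2) ne
      by (auto simp: med_family_def ed_family_def eventually_different_def dest: pairwiseD)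
    then have "finite (\<phi> -` agreement_set UNIV f g \<inter> A)"
      using \<phi> by (intro finite_vimage_IntI) (auto simp: bij_betw_def)
    moreover have "agreement_set UNIV (copy_on A f) (copy_on A g)
        \<subseteq> (\<phi> -` agreement_set UNIV f g \<inter> A) \<union> {n. branch_code f n = branch_code g n}"
      by (auto simp: agreement_set_def copy_on_def \<phi>_def split: if_splits)
    ultimately show ?thesis
      unfolding eventually_different_def
      using finite_branch_code_agreement[OF ne] by (meson finite_UnI finite_subset)
  qed
  then have ed: "ed_family UNIV UNIV (copy_on A ` \<F>)"
    unfolding ed_family_def pairwise_def by fastforce
  have "\<exists>f\<in>\<F>. infinite (agreement_set UNIV (copy_on A f) h)" for h
  proof -
    define \<psi> where "\<psi> = inv_into A \<phi>"
    have \<psi>: "\<psi> n \<in> A" "\<phi> (\<psi> n) = n" for n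
      using \<phi> unfolding \<psi>_def by (auto simp: bij_betw_def inv_into_into f_inv_into_f)
    obtain f where f: "f \<in> \<F>" "infinite (agreement_set UNIV f (h \<circ> \<psi>))"
      using med by (auto simp: med_family_iff_meets_infinitely_often PiE_UNIV_domain)
    have "inj \<psi>" by (metis \<psi>(2) injI)
    then have "infinite (\<psi> ` agreement_set UNIV f (h \<circ> \<psi>))"
      using f(2) by (meson finite_imageD inj_on_subset subset_UNIV)
    moreover have "\<psi> ` agreement_set UNIV f (h \<circ> \<psi>) \<subseteq> agreement_set UNIV (copy_on A f) h"
      using \<psi> by (auto simp: agreement_set_def copy_on_def \<phi>_def)
    ultimately show ?thesis
      using f(1) finite_subset by blast
  qed
  with ed show ?thesis
    by (simp add: med_family_iff_meets_infinitely_often)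
qed

theorem proposition2p10:
  fixes \<F> :: "(nat \<Rightarrow> nat) set"
  assumes "med_family UNIV UNIV \<F>"
    and "\<And>\<G> :: (nat \<Rightarrow> nat) set. med_family UNIV UNIV \<G> \<Longrightarrow>
           med_family UNIV UNIV (family_prod \<F> \<G>)"
  shows "van_Douwen \<F>"
proof -
  have "med_family A UNIV (restrict_family \<F> A)" if A: "infinite A" for A
  proof -
    have "\<exists>f\<in>\<F>. infinite (agreement_set A (restrict f A) h)" for h :: "nat \<Rightarrow> nat"
    proof -
      define k :: "nat \<Rightarrow> nat \<times> nat" where
        "k n = (if n \<in> A then (h n, 0) else (0, 0))" for n
      have "med_family UNIV UNIV (family_prod \<F> (copy_on A ` \<F>))"
        using assms A by (intro assms(2) med_family_copy_on)
      then obtain p where "p \<in> family_prod \<F> (copy_on A ` \<F>)"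
          and p: "infinite (agreement_set UNIV p k)"
        by (auto simp: med_family_iff_meets_infinitely_often PiE_UNIV_domain)
      then obtain f g where f: "f \<in> \<F>" and pfg: "p = fun_prod f (copy_on A g)"
        by (auto simp: family_prod_def)
      \<comment> \<open>Off \<open>A\<close> the second coordinate of \<open>p\<close> is positive while that of \<open>k\<close> is \<open>0\<close>.\<close>
      have "agreement_set UNIV p k \<subseteq> agreement_set A (restrict f A) h"
        by (auto simp: pfg agreement_set_def fun_prod_def k_def copy_on_def branch_code_def
            split: if_splits)
      with p f show ?thesis
        using finite_subset by blast
    qed
    moreover have "ed_family A UNIV (restrict_family \<F> A)"
      using assms(1) by (intro ed_family_restrict) (simp add: med_family_def)
    ultimately show ?thesis
      using A by (simp add: med_family_iff_meets_infinitely_often restrict_family_def)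
  qed
  with assms(1) show ?thesis
    by (simp add: van_Douwen_def)
qed

end
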